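(* For a commutative semigroup $X$ the following conditions are equivalent: (1) the semigroup $\lambda(X)$ of maximal linked upfamilies on $X$ is commutative; (2) for any symmetric matrices $(a_{ij})_{i,j\in\omega},(b_{ij})_{i,j\in\omega}\in X^{\omega\times\omega}$ we have $\{a_{ii}\cdot b_{ij}\}_{i,j\in\omega}\cap\{b_{ii}\cdot a_{i+1,j}\}_{i,j\in\omega}\ne\emptyset$.
   Context: $\omega=\{0,1,2,\dots\}$. An upfamily on a nonempty set $X$ is a nonempty family $\mathcal F$ of nonempty subsets of $X$ such that $F\in\mathcal F$ and $F\subset E\subset X$ imply $E\in\mathcal F$; $\upsilon(X)$ is the set of all upfamilies on $X$. A family $\mathcal G$ of nonempty subsets of $X$ generates the upfamily $\langle G:G\in\mathcal G\rangle=\{E\subset X:\exists G\in\mathcal G,\ G\subset E\}$. An upfamily $\mathcal F$ is linked if $A\cap B\ne\emptyset$ for all $A,B\in\mathcal F$; it is maximal linked if it is linked and coincides with every linked upfamily containing it. $\lambda(X)$ (the superextension of $X$) is the set of maximal linked upfamilies. If $X$ is a semigroup, put for $\mathcal A,\mathcal B\in\upsilon(X)$: $\mathcal A*\mathcal B=\langle\bigcup_{a\in A}aB_a: A\in\mathcal A,\ (B_a)_{a\in A}\in\mathcal B^A\rangle$. The operation $*$ is associative and $\lambda(X)$ is a subsemigroup of $(\upsilon(X),* )$; commutativity of $\lambda(X)$ refers to $*$. A matrix $(b_{ij})$ is symmetric if $b_{ij}=b_{ji}$ for all $i,j$. *)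

theory Defs
  imports Main "HOL-Library.FuncSet"
begin

text \<open>The ground set \<open>X\<close> is the whole type \<open>'a\<close>.\<close>

definition upfamily :: "'a set set \<Rightarrow> bool" where
  "upfamily \<F> \<longleftrightarrow> \<F> \<noteq> {} \<and> {} \<notin> \<F> \<and> (\<forall>F\<in>\<F>. \<forall>E. F \<subseteq> E \<longrightarrow> E \<in> \<F>)"

definition generated_upfamily :: "'a set set \<Rightarrow> 'a set set" where
  "generated_upfamily \<G> = {E. \<exists>G\<in>\<G>. G \<subseteq> E}"

definition linked :: "'a set set \<Rightarrow> bool" where
  "linked \<F> \<longleftrightarrow> (\<forall>A\<in>\<F>. \<forall>B\<in>\<F>. A \<inter> B \<noteq> {})"

definition linked_upfamily :: "'a set set \<Rightarrow> bool" where
  "linked_upfamily \<F> \<longleftrightarrow> upfamily \<F> \<and> linked \<F>"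

definition maximal_linked :: "'a set set \<Rightarrow> bool" where
  "maximal_linked \<F> \<longleftrightarrow> linked_upfamily \<F> \<and> (\<forall>\<G>. linked_upfamily \<G> \<and> \<F> \<subseteq> \<G> \<longrightarrow> \<G> = \<F>)"

definition superextension :: "'a set set set" where
  "superextension = {\<F>. maximal_linked \<F>}"

definition upfamily_mult :: "'a::semigroup_mult set set \<Rightarrow> 'a set set \<Rightarrow> 'a set set"
    (infixl "\<star>" 70) where
  "\<A> \<star> \<B> = generated_upfamily {\<Union>a\<in>A. (\<lambda>x. a * x) ` B a | A B. A \<in> \<A> \<and> B \<in> A \<rightarrow>\<^sub>E \<B>}"

definition symmetric_matrix :: "(nat \<Rightarrow> nat \<Rightarrow> 'a) \<Rightarrow> bool" where
  "symmetric_matrix m \<longleftrightarrow> (\<forall>i j. m i j = m j i)"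

end

theory Submission
  imports Defs
begin

text \<open>For maximal linked \<open>\<A>\<close> and \<open>\<B>\<close>, a set \<open>D\<close> lies in \<open>\<A> \<star> \<B>\<close> iff
  \<open>{a. a\<^sup>-\<^sup>1D \<in> \<B>} \<in> \<A>\<close>, so that \<open>\<A> \<star> \<B>\<close> contains exactly one of \<open>D\<close>, \<open>- D\<close>.
  Hence noncommutativity means \<open>D \<in> \<A> \<star> \<B>\<close> and \<open>- D \<in> \<B> \<star> \<A>\<close> for some \<open>D\<close>; picking the diagonals
  alternately and then the remaining entries in pairwise intersections of the sets \<open>a\<^sub>i\<^sub>i\<^sup>-\<^sup>1D\<close> and
  \<open>b\<^sub>i\<^sub>i\<^sup>-\<^sup>1(- D)\<close> gives matrices violating the matrix condition. Conversely, in symmetric matrices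
  the rows together with the diagonal are linked, so they extend to maximal linked upfamilies whose
  two products contain disjoint sets as soon as the matrix condition fails.\<close>

section \<open>Linked families and their maximal linked extensions\<close>

lemma upfamily_mono: "upfamily \<F> \<Longrightarrow> F \<in> \<F> \<Longrightarrow> F \<subseteq> E \<Longrightarrow> E \<in> \<F>"
  unfolding upfamily_def by blast

lemma linkedD: "linked \<F> \<Longrightarrow> A \<in> \<F> \<Longrightarrow> B \<in> \<F> \<Longrightarrow> A \<inter> B \<noteq> {}"
  unfolding linked_def by blast

lemma superextensionD:
  assumes "\<F> \<in> superextension"
  shows "upfamily \<F>" and "linked \<F>"
  using assms unfolding superextension_def maximal_linked_def linked_upfamily_def by auto

lemma linked_upfamily_generated:
  assumes "\<G> \<noteq> {}" and "linked \<G>"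
  shows "linked_upfamily (generated_upfamily \<G>)"
proof -
  have "A \<inter> B \<noteq> {}" if "A \<in> generated_upfamily \<G>" "B \<in> generated_upfamily \<G>" for A B
    using that assms(2) unfolding generated_upfamily_def linked_def by blast
  then have "linked (generated_upfamily \<G>)"
    unfolding linked_def by blast
  moreover from this have "upfamily (generated_upfamily \<G>)"
    using assms(1) unfolding linked_def upfamily_def generated_upfamily_def by blast
  ultimately show ?thesis
    unfolding linked_upfamily_def by blast
qed

text \<open>Zorn's lemma among the linked upfamilies that contain \<open>\<G>\<close>; any two
  members of the union of a chain already lie in one link of the chain.\<close>

lemma linked_extends_to_superextension:
  assumes "\<G> \<noteq> {}" and "linked \<G>"
  obtains \<F> where "\<F> \<in> superextension" and "\<G> \<subseteq> \<F>"
proof -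
  let ?S = "{\<F>. linked_upfamily \<F> \<and> \<G> \<subseteq> \<F>}"
  have "generated_upfamily \<G> \<in> ?S"
    using linked_upfamily_generated[OF assms] unfolding generated_upfamily_def by blast
  then have ne: "?S \<noteq> {}"
    by blast
  have chain: "\<Union>\<C> \<in> ?S" if "\<C> \<noteq> {}" and "subset.chain ?S \<C>" for \<C>
  proof -
    have mem: "\<And>\<F>. \<F> \<in> \<C> \<Longrightarrow> upfamily \<F> \<and> linked \<F> \<and> \<G> \<subseteq> \<F>"
      and tot: "\<And>\<F> \<H>. \<F> \<in> \<C> \<Longrightarrow> \<H> \<in> \<C> \<Longrightarrow> \<F> \<subseteq> \<H> \<or> \<H> \<subseteq> \<F>"
      using that(2) unfolding subset_chain_def linked_upfamily_def by auto
    have "A \<inter> B \<noteq> {}" if AB: "A \<in> \<Union>\<C>" "B \<in> \<Union>\<C>" for A B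
    proof -
      obtain \<F> \<H> where FH: "\<F> \<in> \<C>" "A \<in> \<F>" "\<H> \<in> \<C>" "B \<in> \<H>"
        using AB by blast
      have "\<F> \<subseteq> \<H> \<or> \<H> \<subseteq> \<F>"
        by (rule tot[OF FH(1,3)])
      then show ?thesis
        using FH mem[OF FH(1)] mem[OF FH(3)] linkedD[of \<F> A B] linkedD[of \<H> A B] by blast
    qed
    then have "linked (\<Union>\<C>)"
      unfolding linked_def by blast
    moreover have sub: "\<G> \<subseteq> \<Union>\<C>"
      using mem that(1) by blast
    moreover have "upfamily (\<Union>\<C>)"
      unfolding upfamily_def
    proof (intro conjI ballI allI impI)
      show "\<Union>\<C> \<noteq> {}"
        using sub assms(1) by blast
      show "{} \<notin> \<Union>\<C>"
        using linkedD[OF \<open>linked (\<Union>\<C>)\<close>, of "{}" "{}"] by blast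
      show "E \<in> \<Union>\<C>" if "F \<in> \<Union>\<C>" "F \<subseteq> E" for F E
        using that mem upfamily_mono by (meson UnionE UnionI)
    qed
    ultimately show ?thesis
      unfolding linked_upfamily_def by blast
  qed
  have "\<exists>\<M>\<in>?S. \<forall>\<H>\<in>?S. \<M> \<subseteq> \<H> \<longrightarrow> \<H> = \<M>"
    by (rule subset_Zorn_nonempty[OF ne]) (rule chain)
  then obtain \<M> where M: "\<M> \<in> ?S" "\<forall>\<H>\<in>?S. \<M> \<subseteq> \<H> \<longrightarrow> \<H> = \<M>"
    by (elim bexE)
  show thesis
  proof (rule that)
    \<comment> \<open>A linked upfamily above \<open>\<M>\<close> contains \<open>\<G>\<close> as
      well, so maximality in \<open>?S\<close> is maximality among all linked upfamilies.\<close>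
    show "\<M> \<in> superextension"
      using M unfolding superextension_def maximal_linked_def by auto
    show "\<G> \<subseteq> \<M>"
      using M(1) by simp
  qed
qed

text \<open>If \<open>- S\<close> is missing, no member is contained in \<open>- S\<close>, so every
  member meets \<open>S\<close> and \<open>S\<close> can be added without losing linkedness;
  maximality then puts \<open>S\<close> into the family.\<close>

lemma Compl_in_superextension_iff:
  assumes "\<F> \<in> superextension"
  shows "- S \<in> \<F> \<longleftrightarrow> S \<notin> \<F>"
proof
  assume "- S \<in> \<F>"
  then show "S \<notin> \<F>"
    using linkedD[OF superextensionD(2)[OF assms]] by blast
next
  note up = superextensionD(1)[OF assms] and li = superextensionD(2)[OF assms]
  assume S: "S \<notin> \<F>"
  show "- S \<in> \<F>"
  proof (rule ccontr)
    assume not_compl: "- S \<notin> \<F>"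
    have meets: "A \<inter> S \<noteq> {}" if "A \<in> \<F>" for A
      using upfamily_mono[OF up that, of "- S"] not_compl by blast
    have "\<F> \<noteq> {}"
      using up unfolding upfamily_def by blast
    then have "S \<noteq> {}"
      using meets by blast
    have "linked (insert S \<F>)"
      using li meets \<open>S \<noteq> {}\<close> unfolding linked_def by blast
    then have "linked_upfamily (generated_upfamily (insert S \<F>))"
      by (intro linked_upfamily_generated) auto
    moreover have "insert S \<F> \<subseteq> generated_upfamily (insert S \<F>)"
      unfolding generated_upfamily_def by blast
    ultimately show False
      using assms S unfolding superextension_def maximal_linked_def by blast
  qed
qed

section \<open>Products: membership, complements, linkedness\<close>

lemma mem_upfamily_mult_iff:
  assumes "upfamily \<A>" and "upfamily \<B>"
  shows "D \<in> \<A> \<star> \<B> \<longleftrightarrow> {a. (\<lambda>x. a * x) -` D \<in> \<B>} \<in> \<A>" (is "_ \<longleftrightarrow> ?A \<in> \<A>")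
proof
  assume "D \<in> \<A> \<star> \<B>"
  then obtain A B where A: "A \<in> \<A>" and B: "B \<in> A \<rightarrow>\<^sub>E \<B>" and D: "(\<Union>a\<in>A. (\<lambda>x. a * x) ` B a) \<subseteq> D"
    unfolding upfamily_mult_def generated_upfamily_def by blast
  have "A \<subseteq> ?A"
  proof
    fix a assume "a \<in> A"
    then have "B a \<in> \<B>" "(\<lambda>x. a * x) ` B a \<subseteq> D"
      using B D by blast+
    then have "B a \<in> \<B>" "B a \<subseteq> (\<lambda>x. a * x) -` D"
      by blast+
    then show "a \<in> ?A"
      using upfamily_mono[OF assms(2)] by blast
  qed
  then show "?A \<in> \<A>"
    using upfamily_mono[OF assms(1) A] by blast
next
  assume A: "?A \<in> \<A>"
  \<comment> \<open>The largest choice of sets whose translates stay inside \<open>D\<close>;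
    \<open>restrict\<close> provides the extensionality demanded by
    \<open>\<rightarrow>\<^sub>E\<close>.\<close>
  define B where "B = restrict (\<lambda>a. (\<lambda>x. a * x) -` D) ?A"
  have "B \<in> ?A \<rightarrow>\<^sub>E \<B>"
    unfolding B_def by auto
  moreover have "(\<Union>a\<in>?A. (\<lambda>x. a * x) ` B a) \<subseteq> D"
    unfolding B_def by auto
  ultimately show "D \<in> \<A> \<star> \<B>"
    using A unfolding upfamily_mult_def generated_upfamily_def by blast
qed

text \<open>Preimages commute with complements, so the dichotomy for complements applies first in
  \<open>\<B>\<close> and then in \<open>\<A>\<close>.\<close>

lemma Compl_in_upfamily_mult_iff:
  assumes "\<A> \<in> superextension" and "\<B> \<in> superextension"
  shows "- D \<in> \<A> \<star> \<B> \<longleftrightarrow> D \<notin> \<A> \<star> \<B>"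
proof -
  have "{a. (\<lambda>x. a * x) -` (- D) \<in> \<B>} = - {a. (\<lambda>x. a * x) -` D \<in> \<B>}"
    by (auto simp: vimage_Compl Compl_in_superextension_iff[OF assms(2)])
  then show ?thesis
    using assms by (simp add: mem_upfamily_mult_iff superextensionD Compl_in_superextension_iff)
qed

lemma linked_upfamily_mult:
  assumes "upfamily \<A>" "linked \<A>" and "upfamily \<B>" "linked \<B>"
  shows "linked (\<A> \<star> \<B>)"
  unfolding linked_def
proof (intro ballI)
  fix D E assume "D \<in> \<A> \<star> \<B>" "E \<in> \<A> \<star> \<B>"
  then have "{a. (\<lambda>x. a * x) -` D \<in> \<B>} \<inter> {a. (\<lambda>x. a * x) -` E \<in> \<B>} \<noteq> {}"
    using linkedD[OF assms(2)] assms(1,3) by (simp add: mem_upfamily_mult_iff)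
  then obtain a where "(\<lambda>x. a * x) -` D \<in> \<B>" "(\<lambda>x. a * x) -` E \<in> \<B>"
    by blast
  from linkedD[OF assms(4) this] show "D \<inter> E \<noteq> {}"
    by blast
qed

section \<open>Symmetric matrices and linked families\<close>

lemma linked_diagonal_rows:
  assumes "symmetric_matrix m"
  shows "linked (insert (range (\<lambda>i. m i i)) (range (\<lambda>i. range (m i))))"
proof -
  \<comment> \<open>Symmetry is what makes two rows meet; the diagonal meets row \<open>i\<close> in
    \<open>m i i\<close> for any matrix.\<close>
  have "range (m i) \<inter> range (m j) \<noteq> {}" for i j
  proof -
    have "m i j = m j i"
      using assms unfolding symmetric_matrix_def by blast
    then show ?thesis
      by (metis disjoint_iff rangeI)
  qed
  then show ?thesis
    unfolding linked_def by blast
qed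

lemma symmetric_matrix_in_superextension:
  assumes "symmetric_matrix m"
  obtains \<F> where "\<F> \<in> superextension" and "range (\<lambda>i. m i i) \<in> \<F>" and "\<And>i. range (m i) \<in> \<F>"
proof -
  obtain \<F> where F: "\<F> \<in> superextension"
    "insert (range (\<lambda>i. m i i)) (range (\<lambda>i. range (m i))) \<subseteq> \<F>"
    by (rule linked_extends_to_superextension[OF insert_not_empty linked_diagonal_rows[OF assms]])
  show thesis
    by (rule that[OF F(1)]) (use F(2) in auto)
qed

lemma symmetric_matrix_intersections:
  assumes "\<And>i j. S i \<inter> S j \<noteq> {}" and "\<And>i. d i \<in> S i"
  obtains m where "symmetric_matrix m" and "\<And>i. m i i = d i" and "\<And>i j. m i j \<in> S i"
proof
  \<comment> \<open>\<open>S i \<inter> S j\<close> and \<open>S j \<inter> S i\<close> are the same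
    set, so \<open>SOME\<close> picks the same element for both and the matrix is symmetric.\<close>
  define m where "m i j = (if i = j then d i else SOME x. x \<in> S i \<inter> S j)" for i j
  show "symmetric_matrix m"
    unfolding symmetric_matrix_def m_def by (simp add: Int_commute)
  show "m i i = d i" for i
    unfolding m_def by simp
  have "(SOME x. x \<in> S i \<inter> S j) \<in> S i \<inter> S j" for i j
    unfolding some_in_eq by (rule assms(1))
  then show "m i j \<in> S i" for i j
    using assms(2) unfolding m_def by auto
qed

text \<open>Linkedness of \<open>\<B>\<close> yields a point of \<open>B\<close> in
  \<open>P x\<close>, and linkedness of \<open>\<A>\<close> a point of \<open>A\<close> in
  \<open>Q y\<close>; the sequences arise in the order \<open>f 0\<close>, \<open>g 0\<close>,
  \<open>f 1\<close>, \<open>g 1\<close> and so on.\<close>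

lemma alternating_sequences:
  assumes "A \<in> \<A>" "linked \<A>" and "\<And>y. y \<in> B \<Longrightarrow> Q y \<in> \<A>"
    and "B \<in> \<B>" "linked \<B>" and "\<And>x. x \<in> A \<Longrightarrow> P x \<in> \<B>"
  obtains f g :: "nat \<Rightarrow> 'a"
  where "\<And>i. f i \<in> A" and "\<And>i. g i \<in> B"
    and "\<And>i. g i \<in> P (f i)" and "\<And>i. f (Suc i) \<in> Q (g i)"
proof -
  have nextB: "\<exists>y. y \<in> B \<and> y \<in> P x" if "x \<in> A" for x
    using linkedD[OF assms(5) assms(4) assms(6)[OF that]] by blast
  have nextA: "\<exists>x. x \<in> A \<and> x \<in> Q y" if "y \<in> B" for y
    using linkedD[OF assms(2) assms(1) assms(3)[OF that]] by blast
  have "A \<noteq> {}"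
    using linkedD[OF assms(2) assms(1) assms(1)] by blast
  then have start: "\<exists>p. fst p \<in> A \<and> snd p \<in> B \<and> snd p \<in> P (fst p)"
    using nextB by auto
  have step: "\<exists>q. (fst q \<in> A \<and> snd q \<in> B \<and> snd q \<in> P (fst q)) \<and> fst q \<in> Q (snd p)"
    if "fst p \<in> A \<and> snd p \<in> B \<and> snd p \<in> P (fst p)" for p
    using that nextA nextB by (metis fst_conv snd_conv)
  \<comment> \<open>Dependent choice runs on the pairs \<open>(f i, g i)\<close>: the condition with
    \<open>P\<close> holds inside a pair, the one with \<open>Q\<close> between consecutive
    pairs.\<close>
  obtain h where
    h: "\<And>i. fst (h i) \<in> A \<and> snd (h i) \<in> B \<and> snd (h i) \<in> P (fst (h i))"
       "\<And>i. fst (h (Suc i)) \<in> Q (snd (h i))"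
    using dependent_nat_choice[of "\<lambda>_ p. fst p \<in> A \<and> snd p \<in> B \<and> snd p \<in> P (fst p)"
        "\<lambda>_ p q. fst q \<in> Q (snd p)"] start step by blast
  then show thesis
    using that[of "fst \<circ> h" "snd \<circ> h"] by simp
qed

text \<open>One inclusion suffices for commutativity, since the hypotheses allow \<open>\<A>\<close>
  and \<open>\<B>\<close> to be exchanged.\<close>

lemma upfamily_mult_le_commuted:
  fixes \<A> \<B> :: "'a::ab_semigroup_mult set set"
  assumes sup: "\<A> \<in> superextension" "\<B> \<in> superextension"
    and matrices: "\<And>a b :: nat \<Rightarrow> nat \<Rightarrow> 'a. symmetric_matrix a \<Longrightarrow> symmetric_matrix b \<Longrightarrow>
      {a i i * b i j | i j. True} \<inter> {b i i * a (i + 1) j | i j. True} \<noteq> {}"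
  shows "\<A> \<star> \<B> \<subseteq> \<B> \<star> \<A>"
proof
  note upA = superextensionD(1)[OF sup(1)] and liA = superextensionD(2)[OF sup(1)]
  note upB = superextensionD(1)[OF sup(2)] and liB = superextensionD(2)[OF sup(2)]
  fix D assume D: "D \<in> \<A> \<star> \<B>"
  show "D \<in> \<B> \<star> \<A>"
  proof (rule ccontr)
    assume "D \<notin> \<B> \<star> \<A>"
    then have D': "- D \<in> \<B> \<star> \<A>"
      by (simp add: Compl_in_upfamily_mult_iff sup)
    define P Q where "P x = (\<lambda>z. x * z) -` D" and "Q y = (\<lambda>z. y * z) -` (- D)" for x y
    have A: "{x. P x \<in> \<B>} \<in> \<A>" and B: "{y. Q y \<in> \<A>} \<in> \<B>"
      using D D' unfolding P_def Q_def by (simp_all only: mem_upfamily_mult_iff upA upB)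
    obtain f g where f: "\<And>i. P (f i) \<in> \<B>" and g: "\<And>i. Q (g i) \<in> \<A>"
      and gP: "\<And>i. g i \<in> P (f i)" and fQ: "\<And>i. f (Suc i) \<in> Q (g i)"
      using alternating_sequences[OF A liA _ B liB, of Q P] by auto
    obtain b where b: "symmetric_matrix b" "\<And>i. b i i = g i" "\<And>i j. b i j \<in> P (f i)"
      using symmetric_matrix_intersections[of "\<lambda>i. P (f i)" g] linkedD[OF liB f f] gP by blast
    \<comment> \<open>\<open>Q (g i)\<close> has to contain row \<open>i + 1\<close> of
      \<open>a\<close>, because \<open>b i i\<close> multiplies that row; row 0 is unconstrained,
      hence \<open>UNIV\<close>.\<close>
    define R where "R = case_nat UNIV (Q \<circ> g)"
    have R0: "R 0 = UNIV" and RSuc: "\<And>i. R (Suc i) = Q (g i)"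
      unfolding R_def by auto
    have QQ: "Q (g i) \<inter> Q (g j) \<noteq> {}" for i j
      using linkedD[OF liA g g] .
    \<comment> \<open>The case of \<open>QQ\<close> with equal indices makes each
      \<open>Q (g k)\<close> nonempty, so that it meets \<open>UNIV\<close>.\<close>
    have "R i \<inter> R j \<noteq> {}" for i j
      using QQ QQ[of k k for k] by (cases i; cases j) (auto simp: R0 RSuc)
    moreover have "f i \<in> R i" for i
      using fQ by (cases i) (auto simp: R0 RSuc)
    ultimately obtain a where a: "symmetric_matrix a" "\<And>i. a i i = f i" "\<And>i j. a i j \<in> R i"
      using symmetric_matrix_intersections[of R f] by blast
    have "a i i * b i j \<in> D" for i j
      using b(3)[of i j] unfolding a(2) P_def by simp
    then have "{a i i * b i j | i j. True} \<subseteq> D"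
      by blast
    moreover have "b i i * a (i + 1) j \<in> - D" for i j
      using a(3)[of "Suc i" j] unfolding b(2) RSuc Q_def by simp
    then have "{b i i * a (i + 1) j | i j. True} \<subseteq> - D"
      by blast
    ultimately have "{a i i * b i j | i j. True} \<inter> {b i i * a (i + 1) j | i j. True} = {}"
      by blast
    then show False
      using matrices[OF a(1) b(1)] by blast
  qed
qed

text \<open>The row attached to \<open>d i\<close> is mapped into the product set by multiplication
  with \<open>d i\<close>, so the whole diagonal passes the membership test for products.\<close>

lemma diagonal_row_products_in_mult:
  assumes "upfamily \<A>" "upfamily \<B>" and "range d \<in> \<A>" and "\<And>i. range (r i) \<in> \<B>"
  shows "{d i * r i j | i j. True} \<in> \<A> \<star> \<B>" (is "?D \<in> _")
proof -
  have "range d \<subseteq> {x. (\<lambda>z. x * z) -` ?D \<in> \<B>}"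
  proof
    fix x assume "x \<in> range d"
    then obtain i where "x = d i"
      by blast
    then have "range (r i) \<subseteq> (\<lambda>z. x * z) -` ?D"
      by blast
    then show "x \<in> {x. (\<lambda>z. x * z) -` ?D \<in> \<B>}"
      using upfamily_mono[OF assms(2,4)] by blast
  qed
  then show ?thesis
    using upfamily_mono[OF assms(1,3)] by (simp only: mem_upfamily_mult_iff[OF assms(1,2)])
qed

theorem theorem9p1:
  shows "(\<forall>\<A>\<in>superextension. \<forall>\<B>\<in>superextension.
            \<A> \<star> \<B> = \<B> \<star> (\<A> :: 'a::ab_semigroup_mult set set)) \<longleftrightarrow>
         (\<forall>a b :: nat \<Rightarrow> nat \<Rightarrow> 'a. symmetric_matrix a \<and> symmetric_matrix b \<longrightarrow>
            {a i i * b i j | i j. True} \<inter> {b i i * a (i + 1) j | i j. True} \<noteq> {})"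
  (is "?comm \<longleftrightarrow> ?matrices")
proof
  assume ?comm
  show ?matrices
  proof (intro allI impI, elim conjE)
    fix a b :: "nat \<Rightarrow> nat \<Rightarrow> 'a"
    assume "symmetric_matrix a" "symmetric_matrix b"
    obtain \<A> where A: "\<A> \<in> superextension" "range (\<lambda>i. a i i) \<in> \<A>" "\<And>i. range (a i) \<in> \<A>"
      using symmetric_matrix_in_superextension[OF \<open>symmetric_matrix a\<close>] by metis
    obtain \<B> where B: "\<B> \<in> superextension" "range (\<lambda>i. b i i) \<in> \<B>" "\<And>i. range (b i) \<in> \<B>"
      using symmetric_matrix_in_superextension[OF \<open>symmetric_matrix b\<close>] by metis
    note up = superextensionD(1)[OF A(1)] superextensionD(1)[OF B(1)]
    have comm: "\<B> \<star> \<A> = \<A> \<star> \<B>"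
      using \<open>?comm\<close> A(1) B(1) by simp
    have "linked (\<A> \<star> \<B>)"
      using A(1) B(1) by (intro linked_upfamily_mult superextensionD)
    \<comment> \<open>All rows of \<open>a\<close> lie in \<open>\<A>\<close>, so row
      \<open>i + 1\<close> may be attached to \<open>b i i\<close>; by commutativity both product
      sets lie in one linked family and therefore meet.\<close>
    then show "{a i i * b i j | i j. True} \<inter> {b i i * a (i + 1) j | i j. True} \<noteq> {}"
      using diagonal_row_products_in_mult[OF up A(2) B(3)]
        diagonal_row_products_in_mult[OF up(2,1) B(2) A(3), unfolded comm]
      by (rule linkedD)
  qed
next
  assume ?matrices
  then have "\<A> \<star> \<B> \<subseteq> \<B> \<star> \<A>"
    if "\<A> \<in> superextension" "\<B> \<in> superextension" for \<A> \<B> :: "'a set set"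
    using that by (intro upfamily_mult_le_commuted) simp_all
  then show ?comm
    by (intro ballI equalityI)
qed

end
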